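(* Let $Q$ be an irreducible, aperiodic, homogeneous nearest-neighbour random walk on $\mathbb{Z}_+^2$ (as in the context) with $q_{1,-1}=q_{-1,1}=0$, satisfying Conditions A, B.1, B.2, C and D in the form these take under this assumption (listed in the context), and suppose $\rho_1=\frac{q_{1,0}}{q_{-1,0}}<1$ and $\rho_2=\frac{q_{0,1}}{q_{0,-1}}<1$. Then its equilibrium (stationary) distribution is $$\pi_{m,n}=c_0\times\begin{cases}\rho_1^m\rho_2^n,& m>0,\ n>0,\\ \frac{q_{0,1}}{q_{-1,0}+q_{0,1}}\,\rho_2^n,& m=0,\ n\ge0,\\ \frac{q_{0,1}}{q_{-1,0}+q_{0,1}}\,\rho_1^m,& m\ge0,\ n=0,\end{cases}$$ where $$c_0=\frac{(1-\rho_1)(1-\rho_2)(q_{0,1}+q_{-1,0})}{q_{0,1}+q_{-1,0}\,\rho_1\rho_2}.$$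
   Context: Random walk. $Q$ is a discrete-time Markov chain on $\mathbb{Z}_+^2=\{(m,n):m,n=0,1,2,\dots\}$. From $(m,n)$ it moves in one step to $(m+k,n+l)$, $k,l\in\{-1,0,1\}$, with probability: $q_{k,l}$ if $m,n\ge1$ (interior); $q^{(h)}_{k,l}$ if $m\ge1,n=0$ (horizontal boundary), where $q^{(h)}_{k,-1}=0$; $q^{(v)}_{k,l}$ if $m=0,n\ge1$ (vertical boundary), where $q^{(v)}_{-1,l}=0$; $q^{(0)}_{k,l}$ if $m=n=0$, where $q^{(0)}_{k,l}=0$ if $k=-1$ or $l=-1$. In each region the probabilities sum to 1. $Q$ is assumed irreducible and aperiodic. Conditions when $q_{1,-1}=q_{-1,1}=0$: Condition A: $q_{1,1}=q_{-1,-1}=0$. Condition B.1: $q^{(h)}_{1,1}=q_{1,0}$, $q^{(h)}_{1,0}=0$, $q^{(h)}_{-1,0}=q_{-1,0}$, $q^{(h)}_{-1,1}=0$, and $q^{(v)}_{1,1}=q_{0,1}$, $q^{(v)}_{0,1}=0$, $q^{(v)}_{0,-1}=q_{0,-1}$, $q^{(v)}_{1,-1}=0$. Condition B.2: $q^{(0)}_{0,1}+q_{0,1}=q^{(h)}_{0,1}+q^{(v)}_{0,1}$, $q^{(0)}_{1,0}+q_{1,0}=q^{(h)}_{1,0}+q^{(v)}_{1,0}$, $q^{(0)}_{1,1}=q^{(h)}_{1,1}+q^{(v)}_{1,1}$. Condition C: $q_{0,1}q_{0,-1}=q_{1,0}q_{-1,0}$. Condition D: $q^{(h)}_{0,1}=q_{0,1}$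 and $q^{(v)}_{1,0}=q_{1,0}$ (equivalently, given B.1 and B.2, $q^{(0)}_{0,1}=q^{(0)}_{1,0}=0$). *)

theory Defs
  imports "HOL-Probability.Probability"
begin

section \<open>Markov chains on a discrete state space\<close>

text \<open>A time-homogeneous chain is given by its transition kernel: \<open>K x\<close> is the law of the
  state reached from \<open>x\<close> in one step.\<close>

primrec n_step :: "('s \<Rightarrow> 's pmf) \<Rightarrow> nat \<Rightarrow> 's \<Rightarrow> 's pmf" where
  "n_step K 0 x = return_pmf x"
| "n_step K (Suc n) x = bind_pmf (K x) (n_step K n)"

definition irreducible_chain :: "('s \<Rightarrow> 's pmf) \<Rightarrow> bool" where
  "irreducible_chain K \<longleftrightarrow> (\<forall>x y. \<exists>n. pmf (n_step K n x) y > 0)"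

definition period :: "('s \<Rightarrow> 's pmf) \<Rightarrow> 's \<Rightarrow> nat" where
  "period K x = Gcd {n. n > 0 \<and> pmf (n_step K n x) x > 0}"

definition aperiodic_chain :: "('s \<Rightarrow> 's pmf) \<Rightarrow> bool" where
  "aperiodic_chain K \<longleftrightarrow> (\<forall>x. period K x = 1)"

definition stationary_distribution :: "('s \<Rightarrow> 's pmf) \<Rightarrow> 's pmf \<Rightarrow> bool" where
  "stationary_distribution K \<mu> \<longleftrightarrow> bind_pmf \<mu> K = \<mu>"

section \<open>Nearest-neighbour random walks on the quarter plane\<close>

text \<open>The walk is given by its increment laws \<open>q\<close> in the interior, \<open>qh\<close> on the horizontal
  boundary, \<open>qv\<close> on the vertical boundary and \<open>q0\<close> at the origin.  The weight \<open>pmf q (k, l)\<close>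
  is the transition probability usually written $q_{k,l}$, and similarly for the others.\<close>

definition nearest_neighbour ::
  "(int \<times> int) pmf \<Rightarrow> (int \<times> int) pmf \<Rightarrow> (int \<times> int) pmf \<Rightarrow> (int \<times> int) pmf \<Rightarrow> bool" where
  "nearest_neighbour q qh qv q0 \<longleftrightarrow>
     set_pmf q \<subseteq> {-1, 0, 1} \<times> {-1, 0, 1} \<and>
     set_pmf qh \<subseteq> {-1, 0, 1} \<times> {0, 1} \<and>
     set_pmf qv \<subseteq> {0, 1} \<times> {-1, 0, 1} \<and>
     set_pmf q0 \<subseteq> {0, 1} \<times> {0, 1}"

definition increment_law ::
  "(int \<times> int) pmf \<Rightarrow> (int \<times> int) pmf \<Rightarrow> (int \<times> int) pmf \<Rightarrow> (int \<times> int) pmf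
    \<Rightarrow> nat \<times> nat \<Rightarrow> (int \<times> int) pmf" where
  "increment_law q qh qv q0 = (\<lambda>(m, n).
     if m > 0 \<and> n > 0 then q
     else if m > 0 then qh
     else if n > 0 then qv
     else q0)"

text \<open>For increment laws satisfying \<open>nearest_neighbour\<close> the coordinates below are nonnegative
  almost surely, so the conversion by \<open>nat\<close> never truncates.\<close>

definition walk_kernel ::
  "(int \<times> int) pmf \<Rightarrow> (int \<times> int) pmf \<Rightarrow> (int \<times> int) pmf \<Rightarrow> (int \<times> int) pmf
    \<Rightarrow> nat \<times> nat \<Rightarrow> (nat \<times> nat) pmf" where
  "walk_kernel q qh qv q0 = (\<lambda>(m, n).
     map_pmf (\<lambda>(k, l). (nat (int m + k), nat (int n + l))) (increment_law q qh qv q0 (m, n)))"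

section \<open>Conditions on the transition probabilities\<close>

text \<open>These are the conditions in the form they take when $q_{1,-1} = q_{-1,1} = 0$.\<close>

definition condition_A :: "(int \<times> int) pmf \<Rightarrow> bool" where
  "condition_A q \<longleftrightarrow> pmf q (1, 1) = 0 \<and> pmf q (-1, -1) = 0"

definition condition_B1 ::
  "(int \<times> int) pmf \<Rightarrow> (int \<times> int) pmf \<Rightarrow> (int \<times> int) pmf \<Rightarrow> bool" where
  "condition_B1 q qh qv \<longleftrightarrow>
     pmf qh (1, 1) = pmf q (1, 0) \<and> pmf qh (1, 0) = 0 \<and>
     pmf qh (-1, 0) = pmf q (-1, 0) \<and> pmf qh (-1, 1) = 0 \<and>
     pmf qv (1, 1) = pmf q (0, 1) \<and> pmf qv (0, 1) = 0 \<and>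
     pmf qv (0, -1) = pmf q (0, -1) \<and> pmf qv (1, -1) = 0"

definition condition_B2 ::
  "(int \<times> int) pmf \<Rightarrow> (int \<times> int) pmf \<Rightarrow> (int \<times> int) pmf \<Rightarrow> (int \<times> int) pmf \<Rightarrow> bool" where
  "condition_B2 q qh qv q0 \<longleftrightarrow>
     pmf q0 (0, 1) + pmf q (0, 1) = pmf qh (0, 1) + pmf qv (0, 1) \<and>
     pmf q0 (1, 0) + pmf q (1, 0) = pmf qh (1, 0) + pmf qv (1, 0) \<and>
     pmf q0 (1, 1) = pmf qh (1, 1) + pmf qv (1, 1)"

definition condition_C :: "(int \<times> int) pmf \<Rightarrow> bool" where
  "condition_C q \<longleftrightarrow> pmf q (0, 1) * pmf q (0, -1) = pmf q (1, 0) * pmf q (-1, 0)"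

definition condition_D ::
  "(int \<times> int) pmf \<Rightarrow> (int \<times> int) pmf \<Rightarrow> (int \<times> int) pmf \<Rightarrow> bool" where
  "condition_D q qh qv \<longleftrightarrow> pmf qh (0, 1) = pmf q (0, 1) \<and> pmf qv (1, 0) = pmf q (1, 0)"

end

theory Submission
  imports Defs
begin

text \<open>Write \<open>east\<close>, \<open>west\<close>, \<open>north\<close>, \<open>south\<close> for the four interior rates; by Condition A and the
  absence of anti-diagonal steps the interior walk has no others besides standing still.  Since
  \<open>\<rho>1 * west = east\<close> and \<open>\<rho>2 * south = north\<close>, the product \<open>\<rho>1 ^ m * \<rho>2 ^ n\<close> balances at
  every state whose neighbours all lie in the interior.  Give each state of the two axes an additional
  factor \<open>\<kappa>\<close>.  At a state \<open>(1, n)\<close> with \<open>n \<ge> 2\<close> the vertical axis must supply what the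
  interior state \<open>(0, n)\<close> would have supplied.  It does so from \<open>(0, n)\<close> at rate \<open>east\<close> and from
  \<open>(0, n - 1)\<close> at rate \<open>north\<close>, so \<open>\<kappa> * (east + north / \<rho>2) = east\<close>, that is,
  \<open>\<kappa> * (east + south) = east\<close>; the balance on the vertical axis itself asks for the same.  The
  horizontal axis asks symmetrically for \<open>\<kappa> * (north + west) = north\<close>.  Condition C,
  \<open>north * south = east * west\<close>, says exactly that both determine the same \<open>\<kappa>\<close>, and then the
  balance at the corner \<open>(1, 1)\<close> and at the origin is an algebraic consequence
  (\<open>weight_balance\<close>).  Summing two geometric series gives the normalising constant
  (\<open>nn_integral_weight\<close>).

  All four rates are positive: without steps to the west the walk could never return to the
  vertical axis, without steps to the south never to the horizontal axis, and then Condition C makes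
  \<open>east\<close> and \<open>north\<close> vanish together, in which case the origin would be absorbing.

  Uniqueness holds for every irreducible chain (\<open>stationary_distribution_unique\<close>): the set
  where one stationary distribution exceeds another cannot be left, so it would be the whole space,
  contradicting that both have total mass 1.\<close>

section \<open>Uniqueness of stationary distributions\<close>

text \<open>Irreducibility is used throughout in this form: a property that no step can destroy holds
  everywhere as soon as it holds somewhere.\<close>

lemma irreducible_chain_invariant:
  assumes "irreducible_chain K" and step: "\<And>x y. P x \<Longrightarrow> y \<in> set_pmf (K x) \<Longrightarrow> P y" and "P x"
  shows "P y"
proof -
  have reach: "P z'" if "P z" "z' \<in> set_pmf (n_step K n z)" for n z z'
    using that
  proof (induction n arbitrary: z)
    case 0
    then show ?case by simp
  next
    case (Suc n)
    then obtain w where "w \<in> set_pmf (K z)" "z' \<in> set_pmf (n_step K n w)"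
      by (auto simp: set_bind_pmf)
    then show ?case using Suc.IH step \<open>P z\<close> by blast
  qed
  obtain n where "pmf (n_step K n x) y > 0"
    using assms(1) unfolding irreducible_chain_def by blast
  hence "y \<in> set_pmf (n_step K n x)" by (simp add: set_pmf_iff)
  with reach \<open>P x\<close> show ?thesis by blast
qed

lemma expectation_count_space:
  fixes f :: "'s \<Rightarrow> real"
  shows "measure_pmf.expectation p f = (\<integral>x. pmf p x * f x \<partial>count_space UNIV)"
  by (simp add: measure_pmf_eq_density integral_density)

lemma integrable_pmf_times_bounded:
  fixes f :: "'s \<Rightarrow> real"
  assumes "\<And>x. \<bar>f x\<bar> \<le> 1"
  shows "integrable (count_space UNIV) (\<lambda>x. pmf p x * f x)"
  by (rule Bochner_Integration.integrable_bound[OF integrable_pmf[of UNIV p]])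
     (use assms in \<open>auto simp: abs_mult intro!: mult_left_le\<close>)

lemma stationary_prob:
  assumes "stationary_distribution K \<mu>"
  shows "measure_pmf.prob \<mu> A = measure_pmf.expectation \<mu> (\<lambda>x. measure_pmf.prob (K x) A)"
proof -
  have "measure_pmf.prob \<mu> A = measure_pmf.prob (bind_pmf \<mu> K) A"
    using assms by (simp add: stationary_distribution_def)
  also have "\<dots> = measure_pmf.expectation \<mu> (\<lambda>x. measure_pmf.prob (K x) A)"
    unfolding measure_pmf_bind
    by (subst measure_pmf.measure_bind[where N = "count_space UNIV"])
       (auto intro!: measurableI simp: space_subprob_algebra
             intro: prob_space_imp_subprob_space measure_pmf.prob_space_axioms)
  finally show ?thesis .
qed

text \<open>Let \<open>A\<close> be the set where \<open>\<mu>\<close> exceeds \<open>\<nu>\<close>.  By stationarity both distributions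
  integrate \<open>indicator A y - prob (K y) A\<close> to 0, hence so does the signed measure \<open>\<mu> - \<nu>\<close>.  But
  against that signed measure the integrand has a sign: on \<open>A\<close> both factors are nonnegative, off
  \<open>A\<close> both are nonpositive.  So it vanishes pointwise, and a state in \<open>A\<close> stays in \<open>A\<close>
  almost surely.\<close>

lemma stationary_excess_absorbing:
  assumes \<mu>: "stationary_distribution K \<mu>" and \<nu>: "stationary_distribution K \<nu>"
    and x: "pmf \<nu> x < pmf \<mu> x"
  shows "set_pmf (K x) \<subseteq> {y. pmf \<nu> y < pmf \<mu> y}"
proof -
  define A where "A = {y. pmf \<nu> y < pmf \<mu> y}"
  define g where "g y = indicator A y - measure_pmf.prob (K y) A" for y
  have g: "\<bar>g y\<bar> \<le> 1" for y
    by (cases "y \<in> A") (auto simp: g_def)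
  have int: "integrable (count_space UNIV) (\<lambda>y. pmf p y * g y)" for p
    by (rule integrable_pmf_times_bounded[OF g])
  have zero: "(\<integral>y. pmf p y * g y \<partial>count_space UNIV) = 0"
    if "stationary_distribution K p" for p
  proof -
    have "(\<integral>y. pmf p y * g y \<partial>count_space UNIV) = measure_pmf.expectation p g"
      by (simp add: expectation_count_space)
    also have "\<dots> = measure_pmf.prob p A - measure_pmf.expectation p (\<lambda>y. measure_pmf.prob (K y) A)"
      unfolding g_def
      by (subst Bochner_Integration.integral_diff)
         (auto intro!: measure_pmf.integrable_const_bound[where B = 1])
    also have "\<dots> = 0" using stationary_prob[OF that] by simp
    finally show ?thesis .
  qed
  let ?h = "\<lambda>y. (pmf \<mu> y - pmf \<nu> y) * g y"
  have h_eq: "?h = (\<lambda>y. pmf \<mu> y * g y - pmf \<nu> y * g y)"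
    by (simp add: left_diff_distrib)
  have "integral\<^sup>L (count_space UNIV) ?h = 0"
    unfolding h_eq using int zero \<mu> \<nu> by (simp add: Bochner_Integration.integral_diff)
  moreover have "integrable (count_space UNIV) ?h"
    unfolding h_eq using int by simp
  moreover have "0 \<le> ?h y" for y
    by (cases "y \<in> A") (auto simp: g_def A_def mult_nonpos_nonneg)
  ultimately have "AE y in count_space UNIV. ?h y = 0"
    by (subst (asm) integral_nonneg_eq_0_iff_AE) auto
  hence "?h x = 0" by (auto simp: AE_count_space)
  with x have "measure_pmf.prob (K x) A = 1" by (simp add: g_def A_def)
  thus ?thesis unfolding A_def by (simp add: measure_pmf.prob_eq_1 AE_measure_pmf_iff subset_iff)
qed

lemma stationary_distribution_unique:
  assumes irr: "irreducible_chain K"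
    and \<mu>: "stationary_distribution K \<mu>" and \<nu>: "stationary_distribution K \<nu>"
  shows "\<mu> = \<nu>"
proof (rule ccontr)
  assume "\<mu> \<noteq> \<nu>"
  then obtain x where x: "pmf \<nu> x < pmf \<mu> x"
    by (metis pmf_neq_exists_less)
  have "pmf \<nu> y < pmf \<mu> y" for y
    by (rule irreducible_chain_invariant[OF irr, where P = "\<lambda>y. pmf \<nu> y < pmf \<mu> y" and x = x])
       (use x stationary_excess_absorbing[OF \<mu> \<nu>] in auto)
  moreover obtain z where "pmf \<mu> z < pmf \<nu> z"
    using \<open>\<mu> \<noteq> \<nu>\<close> by (metis pmf_neq_exists_less)
  ultimately show False by (metis less_asym)
qed

section \<open>Transition probabilities of the walk\<close>

lemma sum_pmf_increments:
  assumes "set_pmf p \<subseteq> {-1, 0, 1} \<times> {-1, 0, 1 :: int}"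
  shows "pmf p (-1, -1) + pmf p (-1, 0) + pmf p (-1, 1) + pmf p (0, -1) + pmf p (0, 0)
       + pmf p (0, 1) + pmf p (1, -1) + pmf p (1, 0) + pmf p (1 :: int, 1) = 1"
proof -
  have "sum (pmf p) ({-1, 0, 1} \<times> {-1, 0, 1}) = 1" by (rule sum_pmf_eq_1) (use assms in auto)
  moreover have "{-1, 0, 1 :: int} \<times> {-1, 0, 1 :: int}
      = {(-1, -1), (-1, 0), (-1, 1), (0, -1), (0, 0), (0, 1), (1, -1), (1, 0), (1, 1)}"
    by auto
  ultimately show ?thesis by simp
qed

text \<open>Supports are handled as products \<open>S \<times> T\<close>; multiplying them out into nine pairs makes the
  simplifier split every membership into nine cases.\<close>

declare insert_Times_insert [simp del]

text \<open>The conversion to natural numbers is injective on the increments that have positive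
  probability, because those never leave the quarter plane.\<close>

lemma pmf_walk_kernel:
  assumes "nearest_neighbour q qh qv q0"
  shows "pmf (walk_kernel q qh qv q0 (i, j)) (m, n)
       = pmf (increment_law q qh qv q0 (i, j)) (int m - int i, int n - int j)"
proof -
  let ?L = "increment_law q qh qv q0 (i, j)"
  let ?f = "\<lambda>(k, l). (nat (int i + k), nat (int j + l))"
  define X :: "nat \<Rightarrow> int set" where "X r = (if r > 0 then {-1, 0, 1} else {0, 1})" for r
  have X_nonneg: "int r + k \<ge> 0" if "k \<in> X r" for r k
    using that by (auto simp: X_def split: if_splits)
  have "set_pmf ?L \<subseteq> X i \<times> X j"
    using assms unfolding nearest_neighbour_def
    by (cases "i > 0"; cases "j > 0") (simp_all add: increment_law_def X_def)
  hence nonneg: "int i + k \<ge> 0" "int j + l \<ge> 0" if "(k, l) \<in> set_pmf ?L" for k l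
    using that X_nonneg by blast+
  have "?f z = (m, n) \<longleftrightarrow> z = (int m - int i, int n - int j)" if "z \<in> set_pmf ?L" for z
    using nonneg[of "fst z" "snd z"] that by (cases z) auto
  hence "?f -` {(m, n)} \<inter> set_pmf ?L = {(int m - int i, int n - int j)} \<inter> set_pmf ?L"
    by blast
  hence "measure_pmf.prob ?L (?f -` {(m, n)})
       = measure_pmf.prob ?L {(int m - int i, int n - int j)}"
    by (metis measure_Int_set_pmf)
  thus ?thesis by (simp add: walk_kernel_def pmf_map measure_pmf_single)
qed

section \<open>The product form and its total mass\<close>

definition weight :: "real \<Rightarrow> real \<Rightarrow> real \<Rightarrow> nat \<times> nat \<Rightarrow> real" where
  "weight \<kappa> \<rho>1 \<rho>2 = (\<lambda>(m, n). (if m > 0 \<and> n > 0 then 1 else \<kappa>) * (\<rho>1 ^ m * \<rho>2 ^ n))"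

lemma nn_integral_weight:
  assumes "0 \<le> \<rho>1" "\<rho>1 < 1" "0 \<le> \<rho>2" "\<rho>2 < 1" "0 \<le> \<kappa>"
  shows "(\<integral>\<^sup>+x. ennreal (weight \<kappa> \<rho>1 \<rho>2 x) \<partial>count_space UNIV)
       = ennreal ((\<rho>1 * \<rho>2 + \<kappa> * (1 - \<rho>1 * \<rho>2)) / ((1 - \<rho>1) * (1 - \<rho>2)))"
proof -
  \<comment> \<open>a geometric series whose term at 0, where the axis is met, is replaced by \<open>B\<close>\<close>
  have shift: "(\<lambda>n. if n > 0 then \<rho> ^ n * A else B) sums (A * (\<rho> / (1 - \<rho>)) + B)"
    if "0 \<le> \<rho>" "\<rho> < 1" for \<rho> A B :: real
  proof -
    have "(\<lambda>n. \<rho> ^ n) sums (1 / (1 - \<rho>))" by (rule geometric_sums) (use that in auto)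
    hence "(\<lambda>n. (A * \<rho>) * \<rho> ^ n) sums ((A * \<rho>) * (1 / (1 - \<rho>)))" by (rule sums_mult)
    thus ?thesis
      using sums_Suc_iff[of "\<lambda>n. if n > 0 then \<rho> ^ n * A else B" "A * (\<rho> / (1 - \<rho>))"]
      by (simp add: mult_ac)
  qed
  define row where "row m = (if m > 0 then \<rho>1 ^ m * (\<rho>2 / (1 - \<rho>2) + \<kappa>) else \<kappa> / (1 - \<rho>2))" for m :: nat
  have "(\<integral>\<^sup>+n. ennreal (weight \<kappa> \<rho>1 \<rho>2 (m, n)) \<partial>count_space UNIV) = ennreal (row m)" for m
  proof -
    have "(\<lambda>n. weight \<kappa> \<rho>1 \<rho>2 (m, n)) sums row m"
    proof (cases "m > 0")
      case True
      have "(\<lambda>n. weight \<kappa> \<rho>1 \<rho>2 (m, n)) = (\<lambda>n. if n > 0 then \<rho>2 ^ n * \<rho>1 ^ m else \<kappa> * \<rho>1 ^ m)"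
        using True by (auto simp: weight_def)
      moreover have "row m = \<rho>1 ^ m * (\<rho>2 / (1 - \<rho>2)) + \<kappa> * \<rho>1 ^ m"
        using True by (simp add: row_def algebra_simps)
      ultimately show ?thesis using shift[of \<rho>2 "\<rho>1 ^ m" "\<kappa> * \<rho>1 ^ m"] assms by simp
    next
      case False
      have "(\<lambda>n. \<kappa> * \<rho>2 ^ n) sums (\<kappa> * (1 / (1 - \<rho>2)))"
        by (intro sums_mult geometric_sums) (use assms in auto)
      with False show ?thesis by (simp add: weight_def row_def)
    qed
    moreover have "0 \<le> weight \<kappa> \<rho>1 \<rho>2 (m, n)" for n using assms by (simp add: weight_def)
    ultimately show ?thesis
      unfolding nn_integral_count_space_nat by (intro suminf_ennreal_eq)
  qed
  moreover have "(\<integral>\<^sup>+m. ennreal (row m) \<partial>count_space UNIV)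
      = ennreal ((\<rho>2 / (1 - \<rho>2) + \<kappa>) * (\<rho>1 / (1 - \<rho>1)) + \<kappa> / (1 - \<rho>2))"
    unfolding nn_integral_count_space_nat
    by (rule suminf_ennreal_eq) (use assms in \<open>auto simp: row_def simp del: times_divide_eq_right intro!: shift\<close>)
  moreover have "(\<rho>2 / (1 - \<rho>2) + \<kappa>) * (\<rho>1 / (1 - \<rho>1)) + \<kappa> / (1 - \<rho>2)
      = (\<rho>1 * \<rho>2 + \<kappa> * (1 - \<rho>1 * \<rho>2)) / ((1 - \<rho>1) * (1 - \<rho>2))"
    using assms by (simp add: divide_simps) (simp add: algebra_simps)
  ultimately show ?thesis by (simp add: nn_integral_fst_count_space[symmetric])
qed

section \<open>The walk under the conditions\<close>

locale conditioned_walk =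
  fixes q qh qv q0 :: "(int \<times> int) pmf"
  assumes neighbour: "nearest_neighbour q qh qv q0"
    and irreducible: "irreducible_chain (walk_kernel q qh qv q0)"
    and no_antidiagonal: "pmf q (1, -1) = 0" "pmf q (-1, 1) = 0"
    and A: "condition_A q"
    and B1: "condition_B1 q qh qv"
    and B2: "condition_B2 q qh qv q0"
    and C: "condition_C q"
    and D: "condition_D q qh qv"
begin

abbreviation "K \<equiv> walk_kernel q qh qv q0"
abbreviation "east \<equiv> pmf q (1, 0)"
abbreviation "west \<equiv> pmf q (-1, 0)"
abbreviation "north \<equiv> pmf q (0, 1)"
abbreviation "south \<equiv> pmf q (0, -1)"

lemma supports:
  "set_pmf q \<subseteq> {-1, 0, 1} \<times> {-1, 0, 1}" "set_pmf qh \<subseteq> {-1, 0, 1} \<times> {0, 1}"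
  "set_pmf qv \<subseteq> {0, 1} \<times> {-1, 0, 1}" "set_pmf q0 \<subseteq> {0, 1} \<times> {0, 1}"
  using neighbour by (simp_all add: nearest_neighbour_def)

lemma supports':
  "set_pmf qh \<subseteq> {-1, 0, 1} \<times> {-1, 0, 1}" "set_pmf qv \<subseteq> {-1, 0, 1} \<times> {-1, 0, 1}"
  "set_pmf q0 \<subseteq> {-1, 0, 1} \<times> {-1, 0, 1}"
  by (rule order_trans[OF supports(2)] order_trans[OF supports(3)] order_trans[OF supports(4)],
      simp add: Sigma_mono)+

lemma outside_support:
  "pmf qh (k, -1) = 0" "pmf qv (-1, l) = 0" "pmf q0 (-1, l) = 0" "pmf q0 (k, -1) = 0"
  using supports(2)[THEN subsetD, of "(k, -1)"] supports(3)[THEN subsetD, of "(-1, l)"]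
    supports(4)[THEN subsetD, of "(-1, l)"] supports(4)[THEN subsetD, of "(k, -1)"]
  by (auto simp: pmf_eq_0_set_pmf)

lemma increments_interior:
  "pmf q (-1, -1) = 0" "pmf q (1, 1) = 0" "pmf q (0, 0) = 1 - east - west - north - south"
proof -
  note total = sum_pmf_increments[OF supports(1)]
  show zero: "pmf q (-1, -1) = 0" "pmf q (1, 1) = 0" using A by (simp_all add: condition_A_def)
  show "pmf q (0, 0) = 1 - east - west - north - south"
    using total no_antidiagonal zero by linarith
qed

lemma increments_horizontal:
  "pmf qh (1, 1) = east" "pmf qh (1, 0) = 0" "pmf qh (-1, 0) = west" "pmf qh (-1, 1) = 0"
  "pmf qh (0, 1) = north" "pmf qh (0, 0) = 1 - east - west - north"
proof -
  note total = sum_pmf_increments[OF supports'(1)]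
  show moves: "pmf qh (1, 1) = east" "pmf qh (1, 0) = 0" "pmf qh (-1, 0) = west"
    "pmf qh (-1, 1) = 0" "pmf qh (0, 1) = north"
    using B1 D by (simp_all add: condition_B1_def condition_D_def)
  show "pmf qh (0, 0) = 1 - east - west - north"
    using total unfolding moves outside_support by simp
qed

lemma increments_vertical:
  "pmf qv (1, 1) = north" "pmf qv (0, 1) = 0" "pmf qv (0, -1) = south" "pmf qv (1, -1) = 0"
  "pmf qv (1, 0) = east" "pmf qv (0, 0) = 1 - east - north - south"
proof -
  note total = sum_pmf_increments[OF supports'(2)]
  show moves: "pmf qv (1, 1) = north" "pmf qv (0, 1) = 0" "pmf qv (0, -1) = south"
    "pmf qv (1, -1) = 0" "pmf qv (1, 0) = east"
    using B1 D by (simp_all add: condition_B1_def condition_D_def)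
  show "pmf qv (0, 0) = 1 - east - north - south"
    using total unfolding moves outside_support by simp
qed

text \<open>Conditions B.1 and D turn the first two equations of B.2 into \<open>pmf q0 (0, 1) = 0\<close> and
  \<open>pmf q0 (1, 0) = 0\<close>: the origin is left only along the diagonal.\<close>

lemma increments_origin:
  "pmf q0 (1, 1) = east + north" "pmf q0 (1, 0) = 0" "pmf q0 (0, 1) = 0"
  "pmf q0 (0, 0) = 1 - east - north"
proof -
  note total = sum_pmf_increments[OF supports'(3)]
  show moves: "pmf q0 (1, 1) = east + north" "pmf q0 (1, 0) = 0" "pmf q0 (0, 1) = 0"
    using B2 increments_horizontal increments_vertical by (simp_all add: condition_B2_def)
  show "pmf q0 (0, 0) = 1 - east - north"
    using total unfolding moves outside_support by simp
qed

lemmas increments = no_antidiagonal outside_support increments_interior increments_horizontal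
  increments_vertical increments_origin

lemma support_increment_law:
  "set_pmf (increment_law q qh qv q0 (m, n)) \<subseteq> {-1, 0, 1} \<times> {-1, 0, 1}"
  by (simp add: increment_law_def supports supports')

lemma increment_of_step:
  assumes "(m, n) \<in> set_pmf (K (i, j))"
  shows "(int m - int i, int n - int j) \<in> set_pmf (increment_law q qh qv q0 (i, j))"
    and "int m - int i \<in> {-1, 0, 1}" and "int n - int j \<in> {-1, 0, 1}"
proof -
  show *: "(int m - int i, int n - int j) \<in> set_pmf (increment_law q qh qv q0 (i, j))"
    using assms unfolding set_pmf_iff pmf_walk_kernel[OF neighbour] .
  show "int m - int i \<in> {-1, 0, 1}" by (rule SigmaD1[OF subsetD[OF support_increment_law *]])
  show "int n - int j \<in> {-1, 0, 1}" by (rule SigmaD2[OF subsetD[OF support_increment_law *]])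
qed

text \<open>Without steps to the west the first coordinate, once positive, would stay positive.\<close>

lemma west_pos: "0 < west"
proof (rule ccontr)
  assume "\<not> 0 < west"
  hence "west = 0" using pmf_nonneg[of q "(-1, 0)"] by linarith
  have no_step: "pmf (increment_law q qh qv q0 (i, j)) (-1, l) = 0" if "i > 0" "l \<in> {-1, 0, 1}" for i j l
    using that \<open>west = 0\<close> by (auto simp: increment_law_def increments)
  have step_pos: "m > 0" if "i > 0" and step: "(m, n) \<in> set_pmf (K (i, j))" for i j m n
  proof (rule ccontr)
    assume "\<not> m > 0"
    moreover have "int m - int i = -1 \<or> int m - int i = 0 \<or> int m - int i = 1"
      using increment_of_step(2)[OF step] by blast
    ultimately have "int m - int i = -1" using \<open>i > 0\<close> by linarith
    with increment_of_step(1)[OF step] no_step[OF \<open>i > 0\<close> increment_of_step(3)[OF step]]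
    show False by (simp add: set_pmf_iff)
  qed
  have "fst ((0, 0) :: nat \<times> nat) > 0"
    by (rule irreducible_chain_invariant[OF irreducible, where P = "\<lambda>y. fst y > 0" and x = "(1, 0)"])
       (use step_pos in \<open>auto simp: split_paired_all\<close>)
  thus False by simp
qed

lemma south_pos: "0 < south"
proof (rule ccontr)
  assume "\<not> 0 < south"
  hence "south = 0" using pmf_nonneg[of q "(0, -1)"] by linarith
  have no_step: "pmf (increment_law q qh qv q0 (i, j)) (l, -1) = 0" if "j > 0" "l \<in> {-1, 0, 1}" for i j l
    using that \<open>south = 0\<close> by (auto simp: increment_law_def increments)
  have step_pos: "n > 0" if "j > 0" and step: "(m, n) \<in> set_pmf (K (i, j))" for i j m n
  proof (rule ccontr)
    assume "\<not> n > 0"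
    moreover have "int n - int j = -1 \<or> int n - int j = 0 \<or> int n - int j = 1"
      using increment_of_step(3)[OF step] by blast
    ultimately have "int n - int j = -1" using \<open>j > 0\<close> by linarith
    with increment_of_step(1)[OF step] no_step[OF \<open>j > 0\<close> increment_of_step(2)[OF step]]
    show False by (simp add: set_pmf_iff)
  qed
  have "snd ((0, 0) :: nat \<times> nat) > 0"
    by (rule irreducible_chain_invariant[OF irreducible, where P = "\<lambda>y. snd y > 0" and x = "(0, 1)"])
       (use step_pos in \<open>auto simp: split_paired_all\<close>)
  thus False by simp
qed

lemma north_south_eq_east_west: "north * south = east * west"
  using C by (simp add: condition_C_def)

text \<open>Condition C lets \<open>north\<close> and \<open>east\<close> vanish only together, and then the origin, whose
  only exit has rate \<open>east + north\<close>, would be absorbing.\<close>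

lemma north_east_pos: "0 < north" "0 < east"
proof -
  have "north = 0 \<longleftrightarrow> east = 0" using north_south_eq_east_west west_pos south_pos by auto
  moreover have "\<not> (north = 0 \<and> east = 0)"
  proof
    assume *: "north = 0 \<and> east = 0"
    hence no_step: "pmf q0 (k, l) = 0" if "k \<in> {-1, 0, 1}" "l \<in> {-1, 0, 1}" "(k, l) \<noteq> (0, 0)" for k l
      using that by (auto simp: increments)
    have step_0: "(m, n) = (0, 0)" if step: "(m, n) \<in> set_pmf (K (0, 0))" for m n
    proof (rule ccontr)
      assume "(m, n) \<noteq> (0, 0)"
      with no_step[OF increment_of_step(2,3)[OF step]] increment_of_step(1)[OF step]
      show False by (simp add: increment_law_def set_pmf_iff)
    qed
    have "(1, 0) = ((0, 0) :: nat \<times> nat)"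
      by (rule irreducible_chain_invariant[OF irreducible, where P = "\<lambda>y. y = (0, 0)" and x = "(0, 0)"])
         (use step_0 in \<open>auto simp: split_paired_all\<close>)
    thus False by simp
  qed
  ultimately show "0 < north" "0 < east"
    using pmf_nonneg[of q "(0, 1)"] pmf_nonneg[of q "(1, 0)"] by linarith+
qed

section \<open>Global balance\<close>

text \<open>The possible predecessors of a coordinate; truncated subtraction merges \<open>-1\<close> with \<open>0\<close>, so
  0 has only two of them.\<close>

lemma predecessors_simps:
  "{0 - 1..0 + 1 :: nat} = {0, 1}" "{Suc 0 - 1..Suc 0 + 1} = {0, 1, 2}"
  "{Suc (Suc m) - 1..Suc (Suc m) + 1} = {Suc m, Suc (Suc m), Suc (Suc (Suc m))}"
  by auto

lemma stationary_iff_balance: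
  "stationary_distribution K \<pi> \<longleftrightarrow>
    (\<forall>m n. (\<Sum>i = m - 1..m + 1. \<Sum>j = n - 1..n + 1. pmf \<pi> (i, j) * pmf (K (i, j)) (m, n)) = pmf \<pi> (m, n))"
proof -
  have "pmf (bind_pmf \<pi> K) (m, n)
      = (\<Sum>i = m - 1..m + 1. \<Sum>j = n - 1..n + 1. pmf \<pi> (i, j) * pmf (K (i, j)) (m, n))" for m n
  proof -
    let ?N = "{m - 1..m + 1} \<times> {n - 1..n + 1}"
    have "x \<in> ?N" if nz: "pmf (K x) (m, n) \<noteq> 0" for x
    proof -
      obtain i j where x: "x = (i, j)" by (cases x)
      have "(m, n) \<in> set_pmf (K (i, j))" using nz by (simp add: x set_pmf_iff)
      from increment_of_step(2,3)[OF this]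
      have "\<bar>int m - int i\<bar> \<le> 1" "\<bar>int n - int j\<bar> \<le> 1" by auto
      thus ?thesis by (simp add: x mem_Times_iff) linarith
    qed
    hence "measure_pmf.expectation \<pi> (\<lambda>x. pmf (K x) (m, n))
         = (\<Sum>x\<in>?N. pmf \<pi> x *\<^sub>R pmf (K x) (m, n))"
      by (intro integral_measure_pmf) auto
    thus ?thesis by (simp add: pmf_bind sum.cartesian_product')
  qed
  thus ?thesis by (simp add: stationary_distribution_def pmf_eq_iff)
qed

text \<open>The factor by which the stationary mass of an axis state falls short of the product form.  It is
  the value forced by the horizontal axis; that it also equals \<open>east / (south + east)\<close>, the value forced
  by the vertical axis, is Condition C.\<close>

definition "\<kappa> = north / (west + north)"

text \<open>Each of the nine kinds of target state (coordinates 0, 1, or at least 2) yields a polynomial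
  identity that follows from the relations defining \<open>\<rho>1\<close> and \<open>\<rho>2\<close> and the two equations for
  \<open>\<kappa>\<close>.\<close>

lemma weight_balance:
  assumes "\<rho>1 = east / west" "\<rho>2 = north / south"
  shows "(\<Sum>i = m - 1..m + 1. \<Sum>j = n - 1..n + 1. weight \<kappa> \<rho>1 \<rho>2 (i, j) * pmf (K (i, j)) (m, n))
       = weight \<kappa> \<rho>1 \<rho>2 (m, n)"
proof -
  note pos = west_pos south_pos north_east_pos
  have E: "east = \<rho>1 * west" and N: "north = \<rho>2 * south" using assms pos by auto
  have k1: "\<kappa> * (west + north) = north" using pos by (simp add: \<kappa>_def)
  have k2: "\<kappa> * (south + east) = east"
    using north_south_eq_east_west pos by (simp add: \<kappa>_def divide_simps) (simp add: algebra_simps)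
  let ?balanced = "\<lambda>m n. (\<Sum>i = m - 1..m + 1. \<Sum>j = n - 1..n + 1.
      weight \<kappa> \<rho>1 \<rho>2 (i, j) * pmf (K (i, j)) (m, n)) = weight \<kappa> \<rho>1 \<rho>2 (m, n)"
  note eval = pmf_walk_kernel[OF neighbour] increment_law_def weight_def increments predecessors_simps
  have "?balanced 0 0" "?balanced 0 (Suc 0)" "?balanced (Suc 0) 0" "?balanced (Suc 0) (Suc 0)"
    by (simp add: eval, use E N k1 k2 in algebra)+
  moreover have "?balanced 0 (Suc (Suc j))" "?balanced (Suc 0) (Suc (Suc j))" for j
  proof -
    \<comment> \<open>naming the common power leaves an identity between polynomials with fixed exponents\<close>
    obtain p where p: "\<rho>2 ^ j = p" by simp
    show "?balanced 0 (Suc (Suc j))" "?balanced (Suc 0) (Suc (Suc j))"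
      by (simp add: eval p, use E N k1 k2 in algebra)+
  qed
  moreover have "?balanced (Suc (Suc i)) 0" "?balanced (Suc (Suc i)) (Suc 0)" for i
  proof -
    obtain p where p: "\<rho>1 ^ i = p" by simp
    show "?balanced (Suc (Suc i)) 0" "?balanced (Suc (Suc i)) (Suc 0)"
      by (simp add: eval p, use E N k1 k2 in algebra)+
  qed
  moreover have "?balanced (Suc (Suc i)) (Suc (Suc j))" for i j
  proof -
    obtain p p' where p: "\<rho>1 ^ i = p" "\<rho>2 ^ j = p'" by simp
    show ?thesis by (simp add: eval p, use E N in algebra)
  qed
  moreover have "m = 0 \<or> m = Suc 0 \<or> (\<exists>i. m = Suc (Suc i))" "n = 0 \<or> n = Suc 0 \<or> (\<exists>i. n = Suc (Suc i))"
    by presburger+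
  ultimately show ?thesis by (elim disjE exE) (simp_all only:)
qed

section \<open>The stationary distribution\<close>

lemma product_form:
  assumes \<rho>1: "\<rho>1 = east / west" "\<rho>1 < 1" and \<rho>2: "\<rho>2 = north / south" "\<rho>2 < 1"
    and c0: "c0 = (1 - \<rho>1) * (1 - \<rho>2) * (north + west) / (north + west * \<rho>1 * \<rho>2)"
  shows "\<exists>\<pi>. stationary_distribution K \<pi> \<and> (\<forall>x. pmf \<pi> x = c0 * weight \<kappa> \<rho>1 \<rho>2 x)"
proof -
  note pos = west_pos south_pos north_east_pos
  have \<rho>_pos: "0 < \<rho>1" "0 < \<rho>2" and \<kappa>_pos: "0 < \<kappa>" using \<rho>1 \<rho>2 pos by (auto simp: \<kappa>_def)
  have denom_pos: "0 < north + west * \<rho>1 * \<rho>2" using pos \<rho>_pos by (intro add_pos_pos mult_pos_pos)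
  hence c0_pos: "0 < c0" unfolding c0 using \<rho>1 \<rho>2 pos by (intro divide_pos_pos mult_pos_pos) auto
  have "(\<rho>1 * \<rho>2 + \<kappa> * (1 - \<rho>1 * \<rho>2)) * (north + west) = north + west * \<rho>1 * \<rho>2"
  proof -
    have "\<kappa> * (north + west) = north" using pos by (simp add: \<kappa>_def add.commute)
    moreover have "(\<rho>1 * \<rho>2 + \<kappa> * (1 - \<rho>1 * \<rho>2)) * (north + west)
        = \<rho>1 * \<rho>2 * (north + west) + \<kappa> * (north + west) * (1 - \<rho>1 * \<rho>2)"
      by (simp add: algebra_simps)
    ultimately show ?thesis by (simp add: algebra_simps)
  qed
  hence mass: "\<rho>1 * \<rho>2 + \<kappa> * (1 - \<rho>1 * \<rho>2) = (north + west * \<rho>1 * \<rho>2) / (north + west)"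
    using pos by (simp add: eq_divide_eq)
  define \<pi> where "\<pi> = embed_pmf (\<lambda>x. c0 * weight \<kappa> \<rho>1 \<rho>2 x)"
  have nonneg: "0 \<le> c0 * weight \<kappa> \<rho>1 \<rho>2 x" for x
    using c0_pos \<rho>_pos \<kappa>_pos by (cases x) (simp add: weight_def)
  have "(\<integral>\<^sup>+x. ennreal (c0 * weight \<kappa> \<rho>1 \<rho>2 x) \<partial>count_space UNIV)
      = ennreal c0 * (\<integral>\<^sup>+x. ennreal (weight \<kappa> \<rho>1 \<rho>2 x) \<partial>count_space UNIV)"
    using c0_pos by (simp add: ennreal_mult' nn_integral_cmult)
  also have "\<dots> = ennreal (c0 * ((\<rho>1 * \<rho>2 + \<kappa> * (1 - \<rho>1 * \<rho>2)) / ((1 - \<rho>1) * (1 - \<rho>2))))"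
    using c0_pos \<rho>_pos \<kappa>_pos \<rho>1(2) \<rho>2(2)
    by (subst nn_integral_weight) (simp_all add: ennreal_mult'[symmetric] del: times_divide_eq_right)
  also have "c0 * ((\<rho>1 * \<rho>2 + \<kappa> * (1 - \<rho>1 * \<rho>2)) / ((1 - \<rho>1) * (1 - \<rho>2))) = 1"
    unfolding mass unfolding c0 using denom_pos pos \<rho>1(2) \<rho>2(2) by simp
  finally have pmf_\<pi>: "pmf \<pi> x = c0 * weight \<kappa> \<rho>1 \<rho>2 x" for x
    unfolding \<pi>_def by (intro pmf_embed_pmf nonneg) simp
  have "stationary_distribution K \<pi>"
    unfolding stationary_iff_balance pmf_\<pi>
    by (simp only: mult.assoc sum_distrib_left[symmetric] weight_balance[OF \<rho>1(1) \<rho>2(1)]) simp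
  with pmf_\<pi> show ?thesis by blast
qed

end

theorem theorem15:
  fixes q qh qv q0 :: "(int \<times> int) pmf" and \<rho>1 \<rho>2 c0 :: real
  assumes "nearest_neighbour q qh qv q0"
    and "irreducible_chain (walk_kernel q qh qv q0)"
    and "aperiodic_chain (walk_kernel q qh qv q0)"
    and "pmf q (1, -1) = 0" and "pmf q (-1, 1) = 0"
    and "condition_A q"
    and "condition_B1 q qh qv"
    and "condition_B2 q qh qv q0"
    and "condition_C q"
    and "condition_D q qh qv"
    and "\<rho>1 = pmf q (1, 0) / pmf q (-1, 0)" and "\<rho>1 < 1"
    and "\<rho>2 = pmf q (0, 1) / pmf q (0, -1)" and "\<rho>2 < 1"
    and "c0 = (1 - \<rho>1) * (1 - \<rho>2) * (pmf q (0, 1) + pmf q (-1, 0)) /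
                (pmf q (0, 1) + pmf q (-1, 0) * \<rho>1 * \<rho>2)"
  shows "\<exists>\<pi>. stationary_distribution (walk_kernel q qh qv q0) \<pi> \<and>
           (\<forall>\<mu>. stationary_distribution (walk_kernel q qh qv q0) \<mu> \<longrightarrow> \<mu> = \<pi>) \<and>
           (\<forall>m n.
             (m > 0 \<and> n > 0 \<longrightarrow> pmf \<pi> (m, n) = c0 * (\<rho>1 ^ m * \<rho>2 ^ n)) \<and>
             (m = 0 \<longrightarrow>
                pmf \<pi> (m, n) = c0 * (pmf q (0, 1) / (pmf q (-1, 0) + pmf q (0, 1)) * \<rho>2 ^ n)) \<and>
             (n = 0 \<longrightarrow>
                pmf \<pi> (m, n) = c0 * (pmf q (0, 1) / (pmf q (-1, 0) + pmf q (0, 1)) * \<rho>1 ^ m)))"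
proof -
  interpret conditioned_walk q qh qv q0
    by unfold_locales fact+
  obtain \<pi> where \<pi>: "stationary_distribution K \<pi>" "\<And>x. pmf \<pi> x = c0 * weight \<kappa> \<rho>1 \<rho>2 x"
    using product_form[OF assms(11-15)] by blast
  show ?thesis
  proof (intro exI[of _ \<pi>] conjI)
    show "stationary_distribution K \<pi>" by (fact \<pi>(1))
    show "\<forall>\<mu>. stationary_distribution K \<mu> \<longrightarrow> \<mu> = \<pi>"
      using stationary_distribution_unique[OF irreducible _ \<pi>(1)] by blast
  qed (simp add: \<pi>(2) weight_def \<kappa>_def)
qed

end
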